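(* Let $N$ be a finite nonempty set of players. The Owen value $\Phi$ satisfies the properties of additivity, null player and necessary players get the weighted coalitional mean, and it is the unique coalitional value $g:\mathcal{G}_N^{cs}\to\mathbb{R}^N$ that satisfies these three properties.
   Context: Fix a finite nonempty set $N$. A cooperative game with player set $N$ is a pair $(N,v)$ with $v:2^N\to\mathbb{R}$, $v(\emptyset)=0$. A coalition structure on $N$ is a partition $P=\{P_1,\dots,P_m\}$ of $N$ into nonempty sets (unions); $M=\{1,\dots,m\}$, $p_k=|P_k|$. A cooperative game with a coalition structure is a triple $(N,v,P)$; $\mathcal{G}_N^{cs}$ is the set of all of them (all $v$, all $P$). A coalitional value is a map $g$ assigning to each $(N,v,P)\in\mathcal{G}_N^{cs}$ a vector $g(N,v,P)\in\mathbb{R}^N$. For $R\subseteq M$ write $P_R=\bigcup_{l\in R}P_l$. The Owen value is, for $i\in P_k$, $$\Phi_i(N,v,P)=\frac{1}{m}\frac{1}{p_k}\sum_{R\subseteq M\setminus\{k\}}\ \sum_{T\subseteq P_k\setminus\{i\}}\frac{1}{\binom{m-1}{|R|}}\frac{1}{\binom{p_k-1}{|T|}}\bigl[v(P_R\cup T\cup\{i\})-v(P_R\cup T)\bigr].$$ A player $i$ is null in $(N,v)$ if $v(S\cup\{i\})=v(S)$ for all $S\subseteq N\setminus\{i\}$, and necessary in $(N,v)$ if $v(S)=0$ for all $S\subseteq N\setminus\{i\}$. Properties of a coalitional value $g$: - Additivity: $g(N,v+w,P)=g(N,v,P)+g(N,w,P)$ for all $v,w,P$. - Null player: $g_i(N,v,P)=0$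 for all $(N,v,P)$ and every null player $i$ of $(N,v)$. - Necessary players get the weighted coalitional mean: for every $(N,v,P)$ and every player $i\in P_k$ necessary in $(N,v)$, $$g_i(N,v,P)=\frac{1}{m}\frac{1}{p_k}\sum_{R\subseteq M\setminus\{k\}}\ \sum_{\emptyset\ne T\subseteq P_k}\frac{1}{\binom{m-1}{|R|}}\frac{1}{\binom{p_k-1}{|T|-1}}v(P_R\cup T).$$ *)

theory Defs
  imports Complex_Main "HOL-Library.FuncSet" "HOL-Library.Disjoint_Sets"
begin

text \<open>
  The player set \<open>N\<close> is an explicit carrier, so maps defined on \<open>Pow N\<close>, on \<open>cs_games N\<close> or on \<open>N\<close>
  are represented by the extensional function spaces \<open>A \<rightarrow>\<^sub>E B\<close>: equality of such functions is
  equality on their domain.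
\<close>

definition games :: "'a set \<Rightarrow> ('a set \<Rightarrow> real) set" where
  "games N = {v \<in> Pow N \<rightarrow>\<^sub>E UNIV. v {} = 0}"

definition game_add :: "'a set \<Rightarrow> ('a set \<Rightarrow> real) \<Rightarrow> ('a set \<Rightarrow> real) \<Rightarrow> 'a set \<Rightarrow> real" where
  "game_add N v w = (\<lambda>S \<in> Pow N. v S + w S)"

text \<open>
  A coalition structure is a set of unions, without a numbering. The unions themselves serve as the
  indices: \<open>M\<close> is \<open>P\<close>, \<open>m\<close> is \<open>card P\<close>, an index set \<open>R\<close> is a subset of \<open>P\<close>, and \<open>P\<^sub>R\<close> is \<open>\<Union>R\<close>.
  As \<open>N\<close> is fixed, a triple \<open>(N, v, P)\<close> is represented by the pair \<open>(v, P)\<close>.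
\<close>

definition cs_games :: "'a set \<Rightarrow> (('a set \<Rightarrow> real) \<times> 'a set set) set" where
  "cs_games N = games N \<times> {P. partition_on N P}"

type_synonym 'a coal_value = "('a set \<Rightarrow> real) \<times> 'a set set \<Rightarrow> 'a \<Rightarrow> real"

definition coal_values :: "'a set \<Rightarrow> 'a coal_value set" where
  "coal_values N = cs_games N \<rightarrow>\<^sub>E (N \<rightarrow>\<^sub>E UNIV)"

definition union_of :: "'a set set \<Rightarrow> 'a \<Rightarrow> 'a set" where
  "union_of P i = (THE B. B \<in> P \<and> i \<in> B)"

definition owen_formula :: "('a set \<Rightarrow> real) \<Rightarrow> 'a set set \<Rightarrow> 'a set \<Rightarrow> 'a \<Rightarrow> real" where
  "owen_formula v P B i =
     1 / real (card P) * (1 / real (card B)) *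
     (\<Sum>R \<in> Pow (P - {B}). \<Sum>T \<in> Pow (B - {i}).
        1 / real ((card P - 1) choose card R) * (1 / real ((card B - 1) choose card T)) *
        (v (\<Union>R \<union> T \<union> {i}) - v (\<Union>R \<union> T)))"

definition owen_value :: "'a set \<Rightarrow> 'a coal_value" where
  "owen_value N = (\<lambda>(v, P) \<in> cs_games N. \<lambda>i \<in> N. owen_formula v P (union_of P i) i)"

definition null_player :: "'a set \<Rightarrow> ('a set \<Rightarrow> real) \<Rightarrow> 'a \<Rightarrow> bool" where
  "null_player N v i \<longleftrightarrow> i \<in> N \<and> (\<forall>S \<subseteq> N - {i}. v (S \<union> {i}) = v S)"

definition necessary_player :: "'a set \<Rightarrow> ('a set \<Rightarrow> real) \<Rightarrow> 'a \<Rightarrow> bool" where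
  "necessary_player N v i \<longleftrightarrow> i \<in> N \<and> (\<forall>S \<subseteq> N - {i}. v S = 0)"

definition additivity :: "'a set \<Rightarrow> 'a coal_value \<Rightarrow> bool" where
  "additivity N g \<longleftrightarrow>
     (\<forall>v w P. (v, P) \<in> cs_games N \<longrightarrow> (w, P) \<in> cs_games N \<longrightarrow>
        (\<forall>i \<in> N. g (game_add N v w, P) i = g (v, P) i + g (w, P) i))"

definition null_player_property :: "'a set \<Rightarrow> 'a coal_value \<Rightarrow> bool" where
  "null_player_property N g \<longleftrightarrow>
     (\<forall>v P i. (v, P) \<in> cs_games N \<longrightarrow> null_player N v i \<longrightarrow> g (v, P) i = 0)"

definition weighted_coalitional_mean :: "('a set \<Rightarrow> real) \<Rightarrow> 'a set set \<Rightarrow> 'a set \<Rightarrow> real" where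
  "weighted_coalitional_mean v P B =
     1 / real (card P) * (1 / real (card B)) *
     (\<Sum>R \<in> Pow (P - {B}). \<Sum>T \<in> Pow B - {{}}.
        1 / real ((card P - 1) choose card R) * (1 / real ((card B - 1) choose (card T - 1))) *
        v (\<Union>R \<union> T))"

definition necessary_players_get_weighted_coalitional_mean :: "'a set \<Rightarrow> 'a coal_value \<Rightarrow> bool" where
  "necessary_players_get_weighted_coalitional_mean N g \<longleftrightarrow>
     (\<forall>v P B i. (v, P) \<in> cs_games N \<longrightarrow> B \<in> P \<longrightarrow> i \<in> B \<longrightarrow> necessary_player N v i \<longrightarrow>
        g (v, P) i = weighted_coalitional_mean v P B)"

end

theory Submission
  imports Defs
begin

text \<open>
  Fix a player \<open>i\<close>. Every game \<open>v\<close> is the sum of \<open>S \<mapsto> v (S - {i})\<close>, in which \<open>i\<close> is null, and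
  \<open>S \<mapsto> v S - v (S - {i})\<close>, in which \<open>i\<close> is necessary. The three properties therefore determine the
  payoff of \<open>i\<close>, and no decomposition into unanimity games is needed. That the Owen value has the
  third property holds because, for necessary \<open>i\<close>, the coalitions without \<open>i\<close> contribute nothing to
  either formula, and \<open>T \<mapsto> T \<union> {i}\<close> matches the remaining terms.
\<close>

lemma union_of_eq:
  assumes "partition_on N P" "B \<in> P" "i \<in> B"
  shows "union_of P i = B"
  unfolding union_of_def
proof (rule the_equality)
  show "C = B" if "C \<in> P \<and> i \<in> C" for C
    using that assms partition_onD2[OF assms(1)] by (auto dest: disjointD)
qed (use assms in blast)

lemma union_of_mem:
  assumes "partition_on N P" "i \<in> N"
  shows "union_of P i \<in> P" "i \<in> union_of P i"
proof -
  obtain B where "B \<in> P" "i \<in> B"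
    using assms by (auto simp: partition_on_def)
  with union_of_eq[OF assms(1)] show "union_of P i \<in> P" "i \<in> union_of P i" by auto
qed

text \<open>Distinct unions are disjoint, so \<open>i\<close>, which lies in \<open>B\<close>, lies
  in no member of \<open>R\<close>. This brings the coalitions of both formulas within reach of the
  null and necessary conditions, which quantify over subsets of \<open>N - {i}\<close>.\<close>

lemma coalition_without_player:
  assumes P: "partition_on N P" and "B \<in> P" "i \<in> B" "R \<subseteq> P - {B}" "T \<subseteq> B - {i}"
  shows "\<Union>R \<union> T \<subseteq> N - {i}"
proof -
  have "i \<notin> C" if "C \<in> R" for C
    using that assms partition_onD2[OF P] by (auto dest: disjointD)
  moreover have "\<Union>R \<union> T \<subseteq> N"
    using assms partition_onD1[OF P] by blast
  ultimately show ?thesis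
    using assms by auto
qed

lemma owen_formula_game_add:
  assumes P: "partition_on N P" and "B \<in> P" "i \<in> B"
  shows "owen_formula (game_add N v w) P B i = owen_formula v P B i + owen_formula w P B i"
proof -
  have add: "game_add N v w (\<Union>R \<union> T \<union> {i}) - game_add N v w (\<Union>R \<union> T) =
      (v (\<Union>R \<union> T \<union> {i}) - v (\<Union>R \<union> T)) + (w (\<Union>R \<union> T \<union> {i}) - w (\<Union>R \<union> T))"
    if "R \<in> Pow (P - {B})" "T \<in> Pow (B - {i})" for R T
  proof -
    have "\<Union>R \<union> T \<subseteq> N - {i}"
      using coalition_without_player[OF assms] that by blast
    moreover have "i \<in> N"
      using assms partition_onD1[OF P] by blast
    \<comment> \<open>\<open>game_add\<close> is the pointwise sum only on \<open>Pow N\<close>, so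
      both coalitions must be located there before it is unfolded.\<close>
    ultimately have "\<Union>R \<union> T \<in> Pow N" "\<Union>R \<union> T \<union> {i} \<in> Pow N" by auto
    then show ?thesis
      unfolding game_add_def by (simp only: restrict_apply if_True)
  qed
  show ?thesis
    \<comment> \<open>The right-hand side is collected into one common factor times one double sum,
      so that both sides can be compared term by term.\<close>
    unfolding owen_formula_def distrib_left[symmetric] sum.distrib[symmetric]
    by (intro arg_cong2[where f = "(*)"] sum.cong refl) (simp only: add)
qed

lemma owen_formula_null_player:
  assumes "partition_on N P" "B \<in> P" "i \<in> B" and null: "null_player N v i"
  shows "owen_formula v P B i = 0"
proof -
  have "v (\<Union>R \<union> T \<union> {i}) - v (\<Union>R \<union> T) = 0"
    if "R \<in> Pow (P - {B})" "T \<in> Pow (B - {i})" for R T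
    using null coalition_without_player[OF assms(1-3)] that unfolding null_player_def by simp
  then show ?thesis
    \<comment> \<open>The congruence rule supplies the membership of \<open>R\<close> and
      \<open>T\<close> in their index sets, on which the vanishing of the marginal contribution
      depends.\<close>
    unfolding owen_formula_def by (simp only: mult_zero_right sum.neutral_const cong: sum.cong)
qed

lemma owen_formula_necessary_player:
  assumes "finite N" and P: "partition_on N P" and B: "B \<in> P" "i \<in> B"
    and nec: "necessary_player N v i"
  shows "owen_formula v P B i = weighted_coalitional_mean v P B"
proof -
  have finB: "finite B"
    using \<open>finite N\<close> B partition_onD1[OF P] by (metis Sup_upper finite_subset)
  have zero: "v (\<Union>R \<union> T) = 0" if "R \<in> Pow (P - {B})" "T \<subseteq> B - {i}" for R T
    using nec coalition_without_player[OF P B] that unfolding necessary_player_def by simp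
  \<comment> \<open>The weight of a coalition inside \<open>B\<close> depends on its size alone: the
    Owen formula uses \<open>c (card T)\<close> with \<open>i\<close> left out, the mean uses
    \<open>c (card T - 1)\<close> with \<open>i\<close> counted. The two double sums are compared
    for each fixed \<open>R\<close>, whose weight becomes \<open>a\<close>.\<close>
  define c where "c k = 1 / real ((card B - 1) choose k)" for k
  have inner: "(\<Sum>T \<in> Pow (B - {i}). a * c (card T) * (v (\<Union>R \<union> T \<union> {i}) - v (\<Union>R \<union> T))) =
      (\<Sum>T \<in> Pow B - {{}}. a * c (card T - 1) * v (\<Union>R \<union> T))"
    if R: "R \<in> Pow (P - {B})" for R and a :: real
  proof -
    have inj: "inj_on (insert i) (Pow (B - {i}))"
      by (rule inj_onI) blast
    have "(\<Sum>T \<in> Pow B - {{}}. a * c (card T - 1) * v (\<Union>R \<union> T)) =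
        (\<Sum>T \<in> insert i ` Pow (B - {i}). a * c (card T - 1) * v (\<Union>R \<union> T))"
    \<comment> \<open>The image of \<open>insert i\<close> consists of the subsets of
      \<open>B\<close> that contain \<open>i\<close>. The other nonempty subsets add zero, since
      \<open>i\<close> is necessary.\<close>
    proof (rule sum.mono_neutral_right)
      show "\<forall>T \<in> Pow B - {{}} - insert i ` Pow (B - {i}). a * c (card T - 1) * v (\<Union>R \<union> T) = 0"
      proof
        fix T assume T: "T \<in> Pow B - {{}} - insert i ` Pow (B - {i})"
        have "i \<notin> T"
        proof
          assume "i \<in> T"
          then have "T = insert i (T - {i})" "T - {i} \<in> Pow (B - {i})" using T by auto
          then show False using T by blast
        qed
        then have "T \<subseteq> B - {i}" using T by auto
        then show "a * c (card T - 1) * v (\<Union>R \<union> T) = 0" by (simp only: zero[OF R] mult_zero_right)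
      qed
    qed (use finB B in auto)
    also have "\<dots> = (\<Sum>T \<in> Pow (B - {i}). a * c (card (insert i T) - 1) * v (\<Union>R \<union> insert i T))"
      by (simp only: sum.reindex[OF inj] o_def)
    also have "\<dots> = (\<Sum>T \<in> Pow (B - {i}). a * c (card T) * (v (\<Union>R \<union> T \<union> {i}) - v (\<Union>R \<union> T)))"
    proof (rule sum.cong[OF refl])
      fix T assume T: "T \<in> Pow (B - {i})"
      then have "finite T" "i \<notin> T"
        using finB by (auto intro: finite_subset)
      \<comment> \<open>This shift by one reconciles the two binomial weights.\<close>
      then have "card (insert i T) - 1 = card T" by simp
      moreover have "v (\<Union>R \<union> T) = 0" using zero[OF R] T by blast
      moreover have "\<Union>R \<union> insert i T = \<Union>R \<union> T \<union> {i}" by blast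
      ultimately show "a * c (card (insert i T) - 1) * v (\<Union>R \<union> insert i T) =
          a * c (card T) * (v (\<Union>R \<union> T \<union> {i}) - v (\<Union>R \<union> T))"
        by (simp only: diff_zero)
    qed
    finally show ?thesis by (rule sym)
  qed
  show ?thesis
    unfolding owen_formula_def weighted_coalitional_mean_def c_def[symmetric]
    by (intro arg_cong2[where f = "(*)"] sum.cong refl inner)
qed

lemma game_add_mem_games:
  "v \<in> games N \<Longrightarrow> w \<in> games N \<Longrightarrow> game_add N v w \<in> games N"
  by (auto simp: games_def game_add_def)

lemma null_necessary_decomposition:
  assumes v: "v \<in> games N" and i: "i \<in> N"
  obtains u w where "u \<in> games N" "w \<in> games N" "v = game_add N u w"
    "null_player N u i" "necessary_player N w i"
proof
  define u where "u = (\<lambda>S \<in> Pow N. v (S - {i}))"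
  define w where "w = (\<lambda>S \<in> Pow N. v S - v (S - {i}))"
  show "u \<in> games N" "w \<in> games N"
    using v by (auto simp: games_def u_def w_def)
  show "v = game_add N u w"
  proof
    fix S
    show "v S = game_add N u w S"
    proof (cases "S \<in> Pow N")
      case True
      then show ?thesis by (simp add: game_add_def u_def w_def)
    next
      case False
      \<comment> \<open>Outside \<open>Pow N\<close> both functions take the default value
        \<open>undefined\<close>, so they agree as functions and not only on coalitions.\<close>
      have "v \<in> Pow N \<rightarrow>\<^sub>E UNIV" using v by (simp add: games_def)
      from PiE_arb[OF this False] False show ?thesis
        by (simp only: game_add_def restrict_apply if_False)
    qed
  qed
  show "null_player N u i"
    unfolding null_player_def
  proof (intro conjI allI impI)
    fix S assume "S \<subseteq> N - {i}"
    then have "S \<union> {i} \<in> Pow N" "S \<in> Pow N" "S \<union> {i} - {i} = S - {i}" using i by auto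
    then show "u (S \<union> {i}) = u S" by (simp only: u_def restrict_apply if_True)
  qed (rule i)
  show "necessary_player N w i"
    unfolding necessary_player_def
  proof (intro conjI allI impI)
    fix S assume "S \<subseteq> N - {i}"
    then have "S \<in> Pow N" "S - {i} = S" by auto
    then show "w S = 0" by (simp only: w_def restrict_apply if_True diff_self)
  qed (rule i)
qed

text \<open>Replaces the definite description in \<open>owen_value\<close> by any union known to
  contain \<open>i\<close>, which is the form that the lemmas on \<open>owen_formula\<close>
  expect.\<close>

lemma owen_value_apply:
  assumes "(v, P) \<in> cs_games N" "B \<in> P" "i \<in> B"
  shows "owen_value N (v, P) i = owen_formula v P B i"
proof -
  have P: "partition_on N P" using assms by (simp add: cs_games_def)
  then have "i \<in> N" using assms partition_onD1 by blast
  then show ?thesis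
    using assms union_of_eq[OF P] by (simp add: owen_value_def)
qed

lemma owen_value_mem_coal_values: "owen_value N \<in> coal_values N"
  by (auto simp: coal_values_def owen_value_def)

lemma additivity_owen_value: "additivity N (owen_value N)"
  unfolding additivity_def
proof (intro allI impI ballI)
  fix v w P i
  assume v: "(v, P) \<in> cs_games N" and w: "(w, P) \<in> cs_games N" and i: "i \<in> N"
  then have vw: "(game_add N v w, P) \<in> cs_games N" and P: "partition_on N P"
    by (auto simp: cs_games_def game_add_mem_games)
  \<comment> \<open>Additivity mentions a player but no union, so the union of \<open>i\<close> is
    supplied by \<open>union_of\<close>.\<close>
  note B = union_of_mem[OF P i]
  show "owen_value N (game_add N v w, P) i = owen_value N (v, P) i + owen_value N (w, P) i"
    by (simp only: owen_value_apply[OF _ B] v w vw owen_formula_game_add[OF P B])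
qed

lemma null_player_property_owen_value: "null_player_property N (owen_value N)"
  unfolding null_player_property_def
proof (intro allI impI)
  fix v P i
  assume v: "(v, P) \<in> cs_games N" and null: "null_player N v i"
  then have P: "partition_on N P" and i: "i \<in> N"
    by (auto simp: cs_games_def null_player_def)
  note B = union_of_mem[OF P i]
  show "owen_value N (v, P) i = 0"
    by (simp only: owen_value_apply[OF v B] owen_formula_null_player[OF P B null])
qed

lemma necessary_players_owen_value:
  assumes "finite N"
  shows "necessary_players_get_weighted_coalitional_mean N (owen_value N)"
  unfolding necessary_players_get_weighted_coalitional_mean_def
proof (intro allI impI)
  fix v P B i
  assume v: "(v, P) \<in> cs_games N" and B: "B \<in> P" "i \<in> B" and nec: "necessary_player N v i"
  then have P: "partition_on N P" by (simp add: cs_games_def)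
  show "owen_value N (v, P) i = weighted_coalitional_mean v P B"
    by (simp only: owen_value_apply[OF v B] owen_formula_necessary_player[OF assms P B nec])
qed

lemma coal_value_unique:
  assumes "g \<in> coal_values N" "additivity N g" "null_player_property N g"
      "necessary_players_get_weighted_coalitional_mean N g"
    and "h \<in> coal_values N" "additivity N h" "null_player_property N h"
      "necessary_players_get_weighted_coalitional_mean N h"
  shows "g = h"
proof -
  \<comment> \<open>The right-hand side does not mention \<open>f\<close>, so any two values with
    the three properties agree on such a sum.\<close>
  have payoff: "f (game_add N u w, P) i = weighted_coalitional_mean w P (union_of P i)"
    if "additivity N f" "null_player_property N f"
      "necessary_players_get_weighted_coalitional_mean N f"
      and P: "partition_on N P" and "u \<in> games N" "w \<in> games N"
      and "null_player N u i" "necessary_player N w i" for f u w P i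
  proof -
    have cs: "(u, P) \<in> cs_games N" "(w, P) \<in> cs_games N" and i: "i \<in> N"
      using that by (auto simp: cs_games_def null_player_def)
    have "f (game_add N u w, P) i = f (u, P) i + f (w, P) i"
      using that cs i unfolding additivity_def by blast
    moreover have "f (u, P) i = 0"
      using that cs unfolding null_player_property_def by blast
    moreover have "f (w, P) i = weighted_coalitional_mean w P (union_of P i)"
      using that cs union_of_mem[OF P i]
      unfolding necessary_players_get_weighted_coalitional_mean_def by blast
    ultimately show ?thesis by simp
  qed
  have "g x = h x" if x: "x \<in> cs_games N" for x
  proof -
    obtain v P where xvP: "x = (v, P)" and v: "v \<in> games N" and P: "partition_on N P"
      using x by (auto simp: cs_games_def)
    have "g x \<in> N \<rightarrow>\<^sub>E UNIV" "h x \<in> N \<rightarrow>\<^sub>E UNIV"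
      using assms x by (auto simp: coal_values_def dest: PiE_mem)
    then show ?thesis
    proof (rule PiE_ext)
      fix i assume "i \<in> N"
      \<comment> \<open>The decomposition depends on \<open>i\<close>, so it is chosen separately
        for each player while the coalition structure stays fixed.\<close>
      with v obtain u w where "u \<in> games N" "w \<in> games N" "v = game_add N u w"
        "null_player N u i" "necessary_player N w i"
        by (rule null_necessary_decomposition)
      then show "g x i = h x i"
        using payoff[OF assms(2-4) P] payoff[OF assms(6-8) P] by (simp add: xvP)
    qed
  qed
  then show ?thesis
    by (rule PiE_ext[OF assms(1,5)[unfolded coal_values_def]])
qed

theorem theorem10:
  fixes N :: "'a set"
  assumes "finite N" and "N \<noteq> {}"
  shows "owen_value N \<in> coal_values N
    \<and> additivity N (owen_value N)
    \<and> null_player_property N (owen_value N)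
    \<and> necessary_players_get_weighted_coalitional_mean N (owen_value N)
    \<and> (\<forall>g \<in> coal_values N.
         additivity N g \<and> null_player_property N g
         \<and> necessary_players_get_weighted_coalitional_mean N g
         \<longrightarrow> g = owen_value N)"
proof (intro conjI ballI impI)
  note necessary = necessary_players_owen_value[OF assms(1)]
  show "necessary_players_get_weighted_coalitional_mean N (owen_value N)" by (rule necessary)
  fix g
  assume "g \<in> coal_values N"
    and "additivity N g \<and> null_player_property N g
      \<and> necessary_players_get_weighted_coalitional_mean N g"
  then show "g = owen_value N"
    by (elim conjE) (rule coal_value_unique[OF _ _ _ _ owen_value_mem_coal_values
        additivity_owen_value null_player_property_owen_value necessary])
qed (rule owen_value_mem_coal_values additivity_owen_value null_player_property_owen_value)+

end
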